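(* Let $f:(0,+\infty)\to\mathbb{R}$ be a locally Lipschitz continuous function such that: (a) for any $M>0$ there exists $C(M)>0$ such that $f(s)-f(t)\le C(M)(s-t)$ for all $0<t\le s\le M$; (b) there exist $c_0,t_0>0$ such that $f(t)>c_0 t$ for all $0<t<t_0$. Let $u\in C^2(\mathbb{R}^N_+)\cap C(\overline{\mathbb{R}^N_+})$ be a solution to $$-\Delta u=f(u)\ \text{ in }\mathbb{R}^N_+,\qquad u>0\ \text{ in }\mathbb{R}^N_+,\qquad u=0\ \text{ on }\partial\mathbb{R}^N_+,$$ with $u\in L^\infty(\Sigma_\lambda)$ for all $\lambda>0$. Then $$\frac{\partial u}{\partial x_N}>0\quad\text{in }\mathbb{R}^N_+.$$
   Context: $N$ is a positive integer (the space dimension). Points of $\mathbb{R}^N$ are written $x=(x',x_N)$ with $x'\in\mathbb{R}^{N-1}$, $x_N\in\mathbb{R}$. $\mathbb{R}^N_+:=\{(x',x_N)\in\mathbb{R}^N\mid x_N>0\}$, and for $\lambda>0$, $\Sigma_\lambda:=\{(x',x_N)\in\mathbb{R}^N\mid 0<x_N<\lambda\}$. The equation is understood in the classical sense in the interior of the domain. *)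

theory Defs
  imports "HOL-Analysis.Analysis"
begin

text \<open>
  The index type of \<open>real ^ 'n\<close> carries no order, so the last coordinate is represented by an
  arbitrary distinguished index \<open>k\<close>: \<open>x $ k\<close> is the coordinate $x_N$, and the other
  components form $x'$. The dimension $N$ is \<open>CARD('n)\<close>, which is positive (and may be 1).
\<close>

definition half_space :: "'n \<Rightarrow> (real ^ 'n::finite) set" where
  "half_space k = {x. 0 < x $ k}"

definition strip :: "'n \<Rightarrow> real \<Rightarrow> (real ^ 'n::finite) set" where
  "strip k l = {x. 0 < x $ k \<and> x $ k < l}"

definition has_partial_at :: "'n \<Rightarrow> (real ^ 'n::finite \<Rightarrow> real) \<Rightarrow> real ^ 'n \<Rightarrow> bool" where
  "has_partial_at i u x \<longleftrightarrow> (\<lambda>t::real. u (x + t *\<^sub>R axis i 1)) differentiable at 0"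

text \<open>Meaningful only at points where \<open>has_partial_at\<close> holds.\<close>

definition partial :: "'n \<Rightarrow> (real ^ 'n::finite \<Rightarrow> real) \<Rightarrow> real ^ 'n \<Rightarrow> real" where
  "partial i u x = deriv (\<lambda>t::real. u (x + t *\<^sub>R axis i 1)) 0"

text \<open>For open \<open>S\<close>; values of \<open>u\<close> outside \<open>S\<close> are then irrelevant.\<close>

definition C1_on :: "(real ^ 'n::finite) set \<Rightarrow> (real ^ 'n \<Rightarrow> real) \<Rightarrow> bool" where
  "C1_on S u \<longleftrightarrow> continuous_on S u \<and>
     (\<forall>i. (\<forall>x\<in>S. has_partial_at i u x) \<and> continuous_on S (partial i u))"

definition C2_on :: "(real ^ 'n::finite) set \<Rightarrow> (real ^ 'n \<Rightarrow> real) \<Rightarrow> bool" where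
  "C2_on S u \<longleftrightarrow> C1_on S u \<and> (\<forall>i. C1_on S (partial i u))"

definition laplacian :: "(real ^ 'n::finite \<Rightarrow> real) \<Rightarrow> real ^ 'n \<Rightarrow> real" where
  "laplacian u x = (\<Sum>i\<in>UNIV. partial i (partial i u) x)"

definition L_infinity_on :: "(real ^ 'n::finite) set \<Rightarrow> (real ^ 'n \<Rightarrow> real) \<Rightarrow> bool" where
  "L_infinity_on S u \<longleftrightarrow> u \<in> borel_measurable (lebesgue_on S) \<and>
     (\<exists>C. AE x in lebesgue_on S. \<bar>u x\<bar> \<le> C)"

text \<open>The library notion concerns families of functions; here the family is constant.\<close>

definition locally_lipschitz_on :: "real set \<Rightarrow> (real \<Rightarrow> real) \<Rightarrow> bool" where
  "locally_lipschitz_on X f \<longleftrightarrow> local_lipschitz (UNIV :: real set) X (\<lambda>_. f)"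

end

theory Submission
  imports Defs
begin

text \<open>
  Moving planes, with barriers for the reflected solution that depend on the height \<open>x $ k\<close> alone. For a
  level \<open>l\<close>, reflect \<open>u\<close> in the plane \<open>x $ k = l\<close> and consider the gap
  \<open>w x = u (reflect k l x) - u x\<close> on the slab \<open>0 \<le> x $ k \<le> l\<close>; it vanishes on the upper face and
  satisfies \<open>laplacian w x = f (u x) - f (u (reflect k l x))\<close>. The aim is \<open>w \<ge> 0\<close> for all \<open>l\<close>.

  The slab is unbounded, so sequences of points need not converge. Instead of compactness the proof
  uses a maximum principle on slabs for functions bounded below (\<open>slab_comparison\<close>) and three estimates
  which are uniform in the horizontal variables. First, since \<open>f\<close> exceeds a linear function
  near \<open>0\<close>, no positive solution can be small at a point where it is touched from below by a
  compactly supported bump of large radius; hence \<open>u\<close> is bounded below by a positive constant on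
  \<open>x $ k \<ge> a\<close> (\<open>uniformly_positive\<close>). Secondly, the one-sided Lipschitz condition bounds \<open>f\<close> from above
  where \<open>u\<close> is not small, and a parabola in the height shows that \<open>u\<close> tends to \<open>0\<close> uniformly at
  the boundary (\<open>uniformly_small_near_boundary\<close>). Thirdly, \<open>f (u x)\<close> is bounded on slabs away from
  the boundary, and a parabola again gives a one-sided vertical Lipschitz bound
  (\<open>vertical_one_sided_lipschitz\<close>).

  The decisive step is \<open>reflection_gap_linear\<close>. If \<open>w \<ge> 0\<close>, the first two estimates make \<open>w\<close>
  bounded below by a positive constant near \<open>x $ k = 0\<close>; above that layer \<open>u\<close> takes values in a
  compact subinterval of the positive half-line, so \<open>laplacian w \<le> L * w\<close>, and an exponential in the
  height is a barrier from below. This yields \<open>w x \<ge> \<kappa> * (l - x $ k)\<close> with \<open>\<kappa> > 0\<close>: a strong maximum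
  principle and a Hopf lemma at once, uniform in the horizontal variables.

  Planes at small height satisfy \<open>w \<ge> 0\<close> because the slab is narrow
  (\<open>below_reflection_narrow\<close>). If the plane at height \<open>l\<close> does, then so does the plane at a slightly
  larger height \<open>m\<close>: below \<open>l - \<delta>\<close> the linear gap absorbs the change of the plane by the vertical
  Lipschitz bound, and the rest is a narrow slab. As the set of good planes is closed, all planes
  are good. The linear gap, read at the plane through a given point, then bounds the vertical
  derivative from below by a positive number.
\<close>

section \<open>Second derivatives along coordinate lines\<close>

text \<open>
  A relation at a single point rather than the value of a derivative operator: sums, multiples and
  reflections of functions then inherit their Laplacians without any discussion of differentiability
  in a neighbourhood. Only derivatives along the line through \<open>x\<close> in direction \<open>i\<close> enter, which is all
  that a maximum principle needs.
\<close>

definition has_second_partial ::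
    "'n \<Rightarrow> (real ^ 'n::finite \<Rightarrow> real) \<Rightarrow> real ^ 'n \<Rightarrow> real \<Rightarrow> bool" where
  "has_second_partial i w x d \<longleftrightarrow>
     (\<exists>p. (\<forall>\<^sub>F t in nhds 0. ((\<lambda>s. w (x + s *\<^sub>R axis i 1)) has_real_derivative p t) (at t)) \<and>
          (p has_real_derivative d) (at 0))"

definition has_laplacian :: "(real ^ 'n::finite \<Rightarrow> real) \<Rightarrow> real ^ 'n \<Rightarrow> real \<Rightarrow> bool" where
  "has_laplacian w x L \<longleftrightarrow> (\<exists>d. (\<forall>i. has_second_partial i w x (d i)) \<and> L = (\<Sum>i\<in>UNIV. d i))"

lemma has_second_partialI:
  assumes "\<And>t. ((\<lambda>s. w (x + s *\<^sub>R axis i 1)) has_real_derivative p t) (at t)"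
    and "(p has_real_derivative d) (at 0)"
  shows "has_second_partial i w x d"
  unfolding has_second_partial_def using assms by (intro exI[of _ p]) auto

lemma has_second_partial_add:
  assumes "has_second_partial i v x a" "has_second_partial i w x b"
  shows "has_second_partial i (\<lambda>y. v y + w y) x (a + b)"
proof -
  obtain p q where
    p: "\<forall>\<^sub>F t in nhds 0. ((\<lambda>s. v (x + s *\<^sub>R axis i 1)) has_real_derivative p t) (at t)"
       "(p has_real_derivative a) (at 0)" and
    q: "\<forall>\<^sub>F t in nhds 0. ((\<lambda>s. w (x + s *\<^sub>R axis i 1)) has_real_derivative q t) (at t)"
       "(q has_real_derivative b) (at 0)"
    using assms unfolding has_second_partial_def by blast
  have "\<forall>\<^sub>F t in nhds 0. ((\<lambda>s. v (x + s *\<^sub>R axis i 1) + w (x + s *\<^sub>R axis i 1))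
          has_real_derivative p t + q t) (at t)"
    using p(1) q(1) by eventually_elim (rule DERIV_add)
  moreover have "((\<lambda>t. p t + q t) has_real_derivative a + b) (at 0)"
    by (rule DERIV_add[OF p(2) q(2)])
  ultimately show ?thesis
    unfolding has_second_partial_def by (intro exI[of _ "\<lambda>t. p t + q t"]) simp
qed

lemma has_second_partial_cmult:
  assumes "has_second_partial i v x a"
  shows "has_second_partial i (\<lambda>y. c * v y) x (c * a)"
proof -
  obtain p where
    p: "\<forall>\<^sub>F t in nhds 0. ((\<lambda>s. v (x + s *\<^sub>R axis i 1)) has_real_derivative p t) (at t)"
       "(p has_real_derivative a) (at 0)"
    using assms unfolding has_second_partial_def by blast
  have "\<forall>\<^sub>F t in nhds 0. ((\<lambda>s. c * v (x + s *\<^sub>R axis i 1)) has_real_derivative c * p t) (at t)"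
    using p(1) by eventually_elim (rule DERIV_cmult)
  moreover have "((\<lambda>t. c * p t) has_real_derivative c * a) (at 0)"
    by (rule DERIV_cmult[OF p(2)])
  ultimately show ?thesis
    unfolding has_second_partial_def by (intro exI[of _ "\<lambda>t. c * p t"]) simp
qed

lemma has_laplacian_add:
  assumes "has_laplacian v x a" "has_laplacian w x b"
  shows "has_laplacian (\<lambda>y. v y + w y) x (a + b)"
proof -
  obtain d e where "\<And>i. has_second_partial i v x (d i)" "a = sum d UNIV"
    "\<And>i. has_second_partial i w x (e i)" "b = sum e UNIV"
    using assms unfolding has_laplacian_def by blast
  then show ?thesis
    unfolding has_laplacian_def
    by (intro exI[of _ "\<lambda>i. d i + e i"]) (simp add: has_second_partial_add sum.distrib)
qed

lemma has_laplacian_cmult: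
  assumes "has_laplacian v x a"
  shows "has_laplacian (\<lambda>y. c * v y) x (c * a)"
proof -
  obtain d where "\<And>i. has_second_partial i v x (d i)" "a = sum d UNIV"
    using assms unfolding has_laplacian_def by blast
  then show ?thesis
    unfolding has_laplacian_def
    by (intro exI[of _ "\<lambda>i. c * d i"]) (simp add: has_second_partial_cmult sum_distrib_left)
qed

lemma has_laplacian_diff:
  assumes "has_laplacian v x a" "has_laplacian w x b"
  shows "has_laplacian (\<lambda>y. v y - w y) x (a - b)"
  using has_laplacian_add[OF assms(1) has_laplacian_cmult[OF assms(2), of "-1"]] by simp

lemma sum_singled_out:
  fixes A B :: real
  shows "(\<Sum>i\<in>(UNIV :: 'n::finite set). if i = k then A else B) = A + (real CARD('n) - 1) * B"
proof -
  have "(\<Sum>i\<in>(UNIV :: 'n set). if i = k then A else B)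
      = (\<Sum>i\<in>(UNIV :: 'n set). B + (if i = k then A - B else 0))"
    by (intro sum.cong) auto
  also have "\<dots> = A + (real CARD('n) - 1) * B"
    by (subst sum.distrib) (simp add: algebra_simps)
  finally show ?thesis .
qed

lemma has_laplacian_height:
  fixes x :: "real ^ 'n::finite"
  assumes "\<And>t. (g has_real_derivative g' t) (at t)"
    and "(g' has_real_derivative g'') (at (x $ k))"
  shows "has_laplacian (\<lambda>y. g (y $ k)) x g''"
proof -
  have "has_second_partial i (\<lambda>y. g (y $ k)) x (if i = k then g'' else 0)" for i
  proof (cases "i = k")
    case True
    have "((\<lambda>s. g (x $ k + s)) has_real_derivative g' (x $ k + t)) (at t)" for t
      using assms(1)[of "x $ k + t"] by (simp add: DERIV_shift add.commute)
    moreover have "((\<lambda>s. g' (x $ k + s)) has_real_derivative g'') (at 0)"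
      using assms(2) DERIV_shift[of g' g'' 0 "x $ k"] by (simp add: add.commute)
    ultimately show ?thesis
      using True by (intro has_second_partialI[where p = "\<lambda>t. g' (x $ k + t)"]) (auto simp: axis_def)
  next
    case False
    then show ?thesis
      by (intro has_second_partialI[where p = "\<lambda>t. 0"]) (auto simp: axis_def)
  qed
  moreover have "g'' = (\<Sum>i\<in>(UNIV::'n set). if i = k then g'' else 0)"
    by simp
  ultimately show ?thesis
    unfolding has_laplacian_def by (intro exI[of _ "\<lambda>i. if i = k then g'' else 0"] conjI allI)
qed

lemma norm_add_axis_sq:
  fixes z :: "real ^ 'n::finite"
  shows "(norm (z + s *\<^sub>R axis i 1))\<^sup>2 = (norm z)\<^sup>2 + 2 * s * z $ i + s\<^sup>2"
proof -
  have "z \<bullet> axis i 1 = z $ i" "axis i 1 \<bullet> z = z $ i"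
    "axis i (1::real) \<bullet> (axis i 1 :: real ^ 'n) = 1"
    by (simp_all add: inner_axis inner_axis' inner_axis_axis)
  then show ?thesis
    unfolding power2_norm_eq_inner by (simp add: inner_add power2_eq_square algebra_simps)
qed

text \<open>
  If the second derivative were negative, the first derivative, which vanishes at the minimum, would be
  negative just to the right, and the function would drop below its minimal value.
\<close>

lemma has_second_partial_local_min:
  assumes d: "has_second_partial i w x d"
    and min: "\<forall>\<^sub>F y in nhds x. w x \<le> w y"
  shows "0 \<le> d"
proof (rule ccontr)
  assume neg: "\<not> 0 \<le> d"
  define g where "g s = w (x + s *\<^sub>R axis i 1)" for s
  obtain p where
    p: "\<forall>\<^sub>F t in nhds 0. (g has_real_derivative p t) (at t)" "(p has_real_derivative d) (at 0)"
    using d unfolding has_second_partial_def g_def by blast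
  have "((\<lambda>s. x + s *\<^sub>R axis i 1) \<longlongrightarrow> x + 0 *\<^sub>R axis i 1) (nhds (0::real))"
    by (intro tendsto_intros) (simp add: filterlim_ident)
  then have "\<forall>\<^sub>F s in nhds 0. g 0 \<le> g s"
    unfolding g_def using eventually_compose_filterlim[OF min] by simp
  with p(1) have "\<forall>\<^sub>F t in nhds 0. (g has_real_derivative p t) (at t) \<and> g 0 \<le> g t"
    by eventually_elim simp
  then obtain e where e: "e > 0"
    "\<And>t. \<bar>t\<bar> < e \<Longrightarrow> (g has_real_derivative p t) (at t)" "\<And>t. \<bar>t\<bar> < e \<Longrightarrow> g 0 \<le> g t"
    unfolding eventually_nhds_metric by (auto simp: dist_real_def)
  have "p 0 = 0"
    using DERIV_local_min[of g "p 0" 0 e] e by auto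
  moreover obtain e' where e': "e' > 0" "\<And>h. 0 < h \<Longrightarrow> h < e' \<Longrightarrow> p (0 + h) < p 0"
    using has_real_derivative_neg_dec_right[OF p(2)] neg by auto
  define h where "h = min e e' / 2"
  have h: "0 < h" "h < e" "h < e'"
    using e(1) e'(1) by (auto simp: h_def)
  have "\<exists>z. 0 < z \<and> z < h \<and> g h - g 0 = (h - 0) * p z"
    using h by (intro MVT2) (auto intro!: e(2))
  then obtain z where z: "0 < z" "z < h" "g h - g 0 = h * p z" by auto
  have "p z < 0"
    using e'(2)[of z] z h \<open>p 0 = 0\<close> by auto
  then have "g h < g 0"
    using z(3) h(1) mult_pos_neg[of h "p z"] by auto
  then show False
    using e(3)[of h] h by auto
qed

text \<open>
  The only form in which the maximum principle is used below: among the multiples of an explicit barrier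
  that stay below a given function, the extreme one touches it.
\<close>

lemma laplacian_le_of_touching_below:
  assumes v: "has_laplacian v x a" and w: "has_laplacian w x b"
    and touch: "w x = v x" and below: "\<forall>\<^sub>F y in nhds x. v y \<le> w y"
  shows "a \<le> b"
proof -
  have "has_laplacian (\<lambda>y. w y - v y) x (b - a)"
    by (rule has_laplacian_diff[OF w v])
  then obtain d where d: "\<And>i. has_second_partial i (\<lambda>y. w y - v y) x (d i)" "b - a = sum d UNIV"
    unfolding has_laplacian_def by blast
  have "\<forall>\<^sub>F y in nhds x. w x - v x \<le> w y - v y"
    using below by eventually_elim (use touch in simp)
  then have "0 \<le> d i" for i
    by (rule has_second_partial_local_min[OF d(1)])
  then have "0 \<le> sum d UNIV"
    by (intro sum_nonneg) auto
  with d(2) show ?thesis by simp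
qed

definition reflect :: "'n \<Rightarrow> real \<Rightarrow> real ^ 'n::finite \<Rightarrow> real ^ 'n" where
  "reflect k l x = x + (2 * (l - x $ k)) *\<^sub>R axis k 1"

lemma reflect_height [simp]: "reflect k l x $ k = 2 * l - x $ k"
  by (simp add: reflect_def)

lemma reflect_fixed: "x $ k = l \<Longrightarrow> reflect k l x = x"
  by (simp add: reflect_def)

lemma continuous_on_reflect [continuous_intros]:
  "continuous_on S g \<Longrightarrow> continuous_on S (\<lambda>x. reflect k l (g x))"
  unfolding reflect_def by (intro continuous_intros)

lemma has_laplacian_reflect:
  assumes "has_laplacian u (reflect k l x) L"
  shows "has_laplacian (\<lambda>y. u (reflect k l y)) x L"
proof -
  obtain d where d: "\<And>i. has_second_partial i u (reflect k l x) (d i)" "L = sum d UNIV"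
    using assms unfolding has_laplacian_def by blast
  have "has_second_partial i (\<lambda>y. u (reflect k l y)) x (d i)" for i
  proof (cases "i = k")
    case False
    then have "reflect k l (x + s *\<^sub>R axis i 1) = reflect k l x + s *\<^sub>R axis i 1" for s
      by (simp add: reflect_def axis_def)
    then show ?thesis
      using d(1)[of i] by (simp add: has_second_partial_def)
  next
    case True
    obtain p where p: "\<forall>\<^sub>F t in nhds 0. ((\<lambda>s. u (reflect k l x + s *\<^sub>R axis k 1))
          has_real_derivative p t) (at t)" "(p has_real_derivative d i) (at 0)"
      using d(1)[of i] True unfolding has_second_partial_def by blast
    have eq: "reflect k l (x + s *\<^sub>R axis k 1) = reflect k l x + (- s) *\<^sub>R axis k 1" for s
      by (simp add: reflect_def algebra_simps flip: scaleR_add_left scaleR_diff_left)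
    have "filterlim (\<lambda>t::real. - t) (nhds 0) (nhds 0)"
      using tendsto_minus[OF filterlim_ident[of "nhds (0::real)"]] by simp
    then have "\<forall>\<^sub>F t in nhds 0. ((\<lambda>s. u (reflect k l x + s *\<^sub>R axis k 1))
          has_real_derivative p (- t)) (at (- t))"
      by (rule eventually_compose_filterlim[OF p(1)])
    then have "\<forall>\<^sub>F t in nhds 0. ((\<lambda>s. u (reflect k l (x + s *\<^sub>R axis k 1)))
          has_real_derivative - p (- t)) (at t)"
    proof eventually_elim
      case (elim t)
      then show ?case
        unfolding eq using DERIV_mirror[of "\<lambda>s. u (reflect k l x + s *\<^sub>R axis k 1)"] by simp
    qed
    moreover have "((\<lambda>t. - p (- t)) has_real_derivative d i) (at 0)"
      using p(2) DERIV_mirror[of p "d i" 0] DERIV_minus[of "\<lambda>t. p (- t)" "- d i"] by simp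
    ultimately show ?thesis
      unfolding has_second_partial_def True by (intro exI[of _ "\<lambda>t. - p (- t)"]) simp
  qed
  then show ?thesis
    using d(2) unfolding has_laplacian_def by blast
qed

section \<open>Slabs and the maximum principle\<close>

definition closed_slab :: "'n \<Rightarrow> real \<Rightarrow> real \<Rightarrow> (real ^ 'n::finite) set" where
  "closed_slab k a b = {x. a \<le> x $ k \<and> x $ k \<le> b}"

lemma closed_closed_slab: "closed (closed_slab k a b)"
proof -
  have "closed_slab k a b = {x. a \<le> x $ k} \<inter> {x. x $ k \<le> b}"
    by (auto simp: closed_slab_def)
  then show ?thesis
    by (auto intro!: closed_Int closed_Collect_le continuous_intros)
qed

lemma eventually_in_open_slab:
  fixes x :: "real ^ 'n::finite"
  assumes "a < x $ k" "x $ k < b"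
  shows "\<forall>\<^sub>F y in nhds x. a < y $ k \<and> y $ k < b"
proof -
  have "open ({y. a < y $ k} \<inter> {y. y $ k < b})"
    by (intro open_Int open_halfspace_component_lt_cart open_halfspace_component_gt_cart)
  then show ?thesis
    using assms eventually_nhds_in_open[of "{y. a < y $ k} \<inter> {y. y $ k < b}" x] by simp
qed

lemma has_laplacian_separated:
  fixes x :: "real ^ 'n::finite" and k :: 'n and \<alpha> \<beta> m :: real
  defines "G \<equiv> \<lambda>y :: real ^ 'n. cos (\<alpha> * (y $ k - m)) * (1 + \<beta> * ((norm y)\<^sup>2 - (y $ k)\<^sup>2))"
  shows "has_laplacian G x
           (- \<alpha>\<^sup>2 * G x + (real CARD('n) - 1) * (2 * \<beta> * cos (\<alpha> * (x $ k - m))))"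
proof -
  define c where "c = cos (\<alpha> * (x $ k - m))"
  define q where "q = 1 + \<beta> * ((norm x)\<^sup>2 - (x $ k)\<^sup>2)"
  have "has_second_partial i G x (if i = k then - \<alpha>\<^sup>2 * G x else 2 * \<beta> * c)" for i
  proof (cases "i = k")
    case True
    have G: "G (x + s *\<^sub>R axis i 1) = q * cos (\<alpha> * (x $ k + s - m))" for s
    proof -
      have "(x + s *\<^sub>R axis i 1) $ k = x $ k + s"
        using True by (simp add: axis_def)
      moreover have "(norm (x + s *\<^sub>R axis i 1))\<^sup>2 - (x $ k + s)\<^sup>2 = (norm x)\<^sup>2 - (x $ k)\<^sup>2"
        using True by (simp add: norm_add_axis_sq power2_sum)
      ultimately show ?thesis
        unfolding G_def q_def by (simp only: mult.commute)
    qed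
    have "has_second_partial i G x (- \<alpha>\<^sup>2 * G x)"
    proof (rule has_second_partialI)
      show "((\<lambda>s. G (x + s *\<^sub>R axis i 1)) has_real_derivative
              - \<alpha> * q * sin (\<alpha> * (x $ k + t - m))) (at t)" for t
        unfolding G by (auto intro!: derivative_eq_intros)
      show "((\<lambda>t. - \<alpha> * q * sin (\<alpha> * (x $ k + t - m))) has_real_derivative - \<alpha>\<^sup>2 * G x) (at 0)"
        by (auto intro!: derivative_eq_intros simp: G_def q_def power2_eq_square)
    qed
    then show ?thesis
      using True by simp
  next
    case False
    have G: "G (x + s *\<^sub>R axis i 1) = c * (q + \<beta> * (2 * s * x $ i + s\<^sup>2))" for s
    proof -
      have height: "(x + s *\<^sub>R axis i 1) $ k = x $ k"
        using False by (simp add: axis_def)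
      show ?thesis
        unfolding G_def q_def c_def norm_add_axis_sq height by (simp add: algebra_simps)
    qed
    have "has_second_partial i G x (2 * \<beta> * c)"
    proof (rule has_second_partialI)
      show "((\<lambda>s. G (x + s *\<^sub>R axis i 1)) has_real_derivative
              c * (\<beta> * (2 * x $ i + 2 * t))) (at t)" for t
        unfolding G by (auto intro!: derivative_eq_intros)
      show "((\<lambda>t. c * (\<beta> * (2 * x $ i + 2 * t))) has_real_derivative 2 * \<beta> * c) (at 0)"
        by (auto intro!: derivative_eq_intros)
    qed
    then show ?thesis
      using False by simp
  qed
  then show ?thesis
    unfolding has_laplacian_def
    by (intro exI[of _ "\<lambda>i. if i = k then - \<alpha>\<^sup>2 * G x else 2 * \<beta> * c"])
      (simp add: sum_singled_out c_def)
qed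

text \<open>
  A barrier that grows in the horizontal directions, so that the ratio of a bounded function to it tends
  to \<open>0\<close> at infinity. Narrowness of the slab leaves room for a cosine of the height that
  is positive up to the faces and whose frequency \<open>\<alpha>\<close> has \<open>\<alpha>\<^sup>2 > C\<close>; multiplying it by a slowly
  growing quadratic in the horizontal variables uses up less than the difference \<open>\<alpha>\<^sup>2 - C\<close>.
\<close>

lemma slab_supersolution:
  fixes a b C :: real and k :: "'n::finite"
  assumes ab: "a < b" and narrow: "C * (b - a)\<^sup>2 < pi\<^sup>2"
  obtains \<beta> \<gamma> and G :: "real ^ 'n \<Rightarrow> real" where
    "0 < \<beta>" "0 < \<gamma>" "continuous_on UNIV G"
    "\<And>x. x \<in> closed_slab k a b \<Longrightarrow> \<gamma> * (1 + \<beta> * ((norm x)\<^sup>2 - (x $ k)\<^sup>2)) \<le> G x"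
    "\<And>x. x \<in> closed_slab k a b \<Longrightarrow> \<exists>L < - C * G x. has_laplacian G x L"
proof -
  define P where "P = pi / (b - a)"
  have P: "0 < P" "C < P\<^sup>2"
    using ab narrow by (auto simp: P_def field_simps power_divide)
  obtain c where c: "max C 0 < c" "c < P\<^sup>2"
    using dense[of "max C 0" "P\<^sup>2"] P by auto
  define \<alpha> where "\<alpha> = sqrt c"
  have \<alpha>: "0 < \<alpha>" "C < \<alpha>\<^sup>2" "\<alpha> * (b - a) < pi"
  proof -
    show "0 < \<alpha>" "C < \<alpha>\<^sup>2"
      using c by (auto simp: \<alpha>_def)
    have "\<alpha> < P"
      using c P real_sqrt_less_mono[of c "P\<^sup>2"] by (simp add: \<alpha>_def)
    then show "\<alpha> * (b - a) < pi"
      using ab by (simp add: P_def field_simps)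
  qed
  define m where "m = (a + b) / 2"
  define \<beta> where "\<beta> = (\<alpha>\<^sup>2 - C) / (2 * real CARD('n))"
  define \<gamma> where "\<gamma> = cos (\<alpha> * (b - a) / 2)"
  define G :: "real ^ 'n \<Rightarrow> real" where
    "G y = cos (\<alpha> * (y $ k - m)) * (1 + \<beta> * ((norm y)\<^sup>2 - (y $ k)\<^sup>2))" for y
  have N: "1 \<le> real CARD('n)"
    using zero_less_card_finite[where 'a = 'n] by linarith
  have \<beta>: "0 < \<beta>" "2 * \<beta> * real CARD('n) = \<alpha>\<^sup>2 - C"
    using \<alpha> N by (auto simp: \<beta>_def)
  have \<gamma>: "0 < \<gamma>"
    unfolding \<gamma>_def using \<alpha> ab by (intro cos_gt_zero) auto
  have cos_ge: "\<gamma> \<le> cos (\<alpha> * (x $ k - m))" if "x \<in> closed_slab k a b" for x :: "real ^ 'n"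
  proof -
    have "\<bar>x $ k - m\<bar> \<le> (b - a) / 2"
      using that by (auto simp: closed_slab_def m_def abs_le_iff field_simps)
    then have "\<alpha> * \<bar>x $ k - m\<bar> \<le> \<alpha> * ((b - a) / 2)"
      using \<alpha>(1) by (intro mult_left_mono) auto
    then have "\<bar>\<alpha> * (x $ k - m)\<bar> \<le> \<alpha> * (b - a) / 2"
      using \<alpha>(1) by (simp add: abs_mult)
    then have "cos (\<alpha> * (b - a) / 2) \<le> cos \<bar>\<alpha> * (x $ k - m)\<bar>"
      using \<alpha>(3) \<alpha>(1) ab pi_gt_zero by (intro cos_monotone_0_pi_le) auto
    then show ?thesis
      by (simp add: \<gamma>_def)
  qed
  have q: "0 \<le> (norm x)\<^sup>2 - (x $ k)\<^sup>2" for x :: "real ^ 'n"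
    using component_le_norm_cart[of x k] by (simp add: abs_le_square_iff[symmetric])
  show thesis
  proof (rule that[of \<beta> \<gamma> G])
    show "continuous_on UNIV G"
      unfolding G_def by (intro continuous_intros)
    show "\<gamma> * (1 + \<beta> * ((norm x)\<^sup>2 - (x $ k)\<^sup>2)) \<le> G x" if "x \<in> closed_slab k a b" for x
      unfolding G_def using cos_ge[OF that] q[of x] \<beta>(1) by (intro mult_right_mono) auto
    show "\<exists>L < - C * G x. has_laplacian G x L" if x: "x \<in> closed_slab k a b" for x
    proof (intro exI conjI)
      let ?c = "cos (\<alpha> * (x $ k - m))"
      let ?L = "- \<alpha>\<^sup>2 * G x + (real CARD('n) - 1) * (2 * \<beta> * ?c)"
      show "has_laplacian G x ?L"
        using has_laplacian_separated[of \<alpha> k m \<beta> x] unfolding G_def[abs_def] .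
      have c: "0 < ?c"
        using \<gamma> cos_ge[OF x] by (rule less_le_trans)
      have "?c * 1 \<le> G x"
        unfolding G_def using c q[of x] \<beta>(1) by (intro mult_left_mono) auto
      then have "(\<alpha>\<^sup>2 - C) * ?c \<le> (\<alpha>\<^sup>2 - C) * G x"
        using \<alpha>(2) by (intro mult_left_mono) auto
      moreover have "(real CARD('n) - 1) * (2 * \<beta> * ?c) = (\<alpha>\<^sup>2 - C) * ?c - 2 * \<beta> * ?c"
        unfolding \<beta>(2)[symmetric] by (simp add: algebra_simps)
      moreover have "0 < 2 * \<beta> * ?c"
        using c \<beta>(1) by simp
      ultimately show "?L < - C * G x"
        by (simp add: algebra_simps)
    qed
  qed (use \<beta> \<gamma> in auto)
qed

text \<open>
  If \<open>w\<close> is negative somewhere, the ratio of \<open>w\<close> to the growing barrier \<open>G\<close> attains a negative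
  minimum \<open>r\<close>, at an interior point. There \<open>r * G\<close> touches \<open>w\<close> from below, and the strict
  inequality for the Laplacian of \<open>G\<close> contradicts that for \<open>w\<close>. For \<open>C = 0\<close> the slab may have any width.
\<close>

lemma slab_comparison:
  fixes w :: "real ^ 'n::finite \<Rightarrow> real"
  assumes ab: "a < b" and narrow: "C * (b - a)\<^sup>2 < pi\<^sup>2"
    and cont: "continuous_on (closed_slab k a b) w"
    and bdd: "\<And>x. x \<in> closed_slab k a b \<Longrightarrow> - B \<le> w x"
    and bottom: "\<And>x. x $ k = a \<Longrightarrow> 0 \<le> w x"
    and top: "\<And>x. x $ k = b \<Longrightarrow> 0 \<le> w x"
    and lap: "\<And>x. a < x $ k \<Longrightarrow> x $ k < b \<Longrightarrow> w x < 0 \<Longrightarrow> \<exists>L \<le> - C * w x. has_laplacian w x L"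
    and x: "x \<in> closed_slab k a b"
  shows "0 \<le> w x"
proof (rule ccontr)
  assume "\<not> 0 \<le> w x"
  then have wx: "w x < 0" by simp
  obtain \<beta> \<gamma> G where \<beta>: "0 < \<beta>" and \<gamma>: "0 < \<gamma>" and contG: "continuous_on UNIV G"
    and G: "\<And>x. x \<in> closed_slab k a b \<Longrightarrow> \<gamma> * (1 + \<beta> * ((norm x)\<^sup>2 - (x $ k)\<^sup>2)) \<le> G x"
    and lapG: "\<And>x. x \<in> closed_slab k a b \<Longrightarrow> \<exists>L < - C * G x. has_laplacian G x L"
    by (rule slab_supersolution[OF ab narrow, where k = k]) (rule that; assumption)
  define q where "q y = (norm y)\<^sup>2 - (y $ k)\<^sup>2" for y :: "real ^ 'n"
  have q: "0 \<le> q y" for y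
    using component_le_norm_cart[of y k] by (simp add: q_def abs_le_square_iff[symmetric])
  have Gpos: "0 < G y" if "y \<in> closed_slab k a b" for y
  proof -
    have "0 < \<gamma> * (1 + \<beta> * q y)"
      using \<gamma> \<beta> q[of y] by (intro mult_pos_pos add_pos_nonneg) auto
    then show ?thesis
      using G[OF that] by (simp add: q_def)
  qed
  define r0 where "r0 = w x / G x"
  have r0: "r0 < 0"
    using wx Gpos[OF x] by (simp add: r0_def divide_neg_pos)
  have B: "0 < B"
    using bdd[OF x] wx by simp
  \<comment> \<open>Where \<open>q y > Q\<close> the growth of \<open>G\<close> keeps \<open>w y / G y\<close> above its value at \<open>x\<close>,
      so the infimum over the slab is attained on the compact set \<open>K\<close>.\<close>
  define Q where "Q = max (q x) (B / (\<gamma> * \<beta> * (- r0)))"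
  define K where "K = closed_slab k a b \<inter> {y. q y \<le> Q}"
  have "compact K"
  proof -
    have "closed {y. q y \<le> Q}"
      unfolding q_def by (intro closed_Collect_le continuous_intros)
    then have "closed K"
      unfolding K_def using closed_closed_slab by (intro closed_Int)
    moreover have "bounded K"
      unfolding bounded_iff
    proof (intro exI ballI)
      fix y assume y: "y \<in> K"
      have "\<bar>y $ k\<bar> \<le> max \<bar>a\<bar> \<bar>b\<bar>"
        using y by (auto simp: K_def closed_slab_def)
      then have "(y $ k)\<^sup>2 \<le> (max \<bar>a\<bar> \<bar>b\<bar>)\<^sup>2"
        by (metis abs_le_square_iff abs_of_nonneg abs_ge_zero order_trans)
      then have "(norm y)\<^sup>2 \<le> Q + (max \<bar>a\<bar> \<bar>b\<bar>)\<^sup>2"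
        using y by (auto simp: K_def q_def)
      then show "norm y \<le> sqrt (Q + (max \<bar>a\<bar> \<bar>b\<bar>)\<^sup>2)"
        using real_le_rsqrt by blast
    qed
    ultimately show ?thesis
      by (simp add: compact_eq_bounded_closed)
  qed
  moreover have "x \<in> K"
    using x by (simp add: K_def Q_def)
  moreover have "continuous_on K (\<lambda>y. w y / G y)"
    using Gpos by (intro continuous_intros continuous_on_subset[OF cont] continuous_on_subset[OF contG])
      (auto simp: K_def less_imp_neq[symmetric])
  ultimately obtain z where z: "z \<in> K" "\<And>y. y \<in> K \<Longrightarrow> w z / G z \<le> w y / G y"
    using continuous_attains_inf[of K "\<lambda>y. w y / G y"] by blast
  define r where "r = w z / G z"
  have zS: "z \<in> closed_slab k a b"
    using z(1) by (simp add: K_def)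
  have r: "r \<le> r0"
    using z(2)[OF \<open>x \<in> K\<close>] by (simp add: r_def r0_def)
  have wz: "w z = r * G z"
    using Gpos[OF zS] by (simp add: r_def)
  have below: "r * G y \<le> w y" if y: "y \<in> closed_slab k a b" for y
  proof (cases "q y \<le> Q")
    case True
    then show ?thesis
      using z(2)[of y] y Gpos[OF y] by (simp add: K_def r_def field_simps)
  next
    case False
    then have "B / (\<gamma> * \<beta> * (- r0)) \<le> q y"
      by (simp add: Q_def)
    moreover have "0 < \<gamma> * \<beta> * (- r0)"
      using \<gamma> \<beta> r0 by (intro mult_pos_pos) auto
    ultimately have "B \<le> q y * (\<gamma> * \<beta> * (- r0))"
      by (subst (asm) pos_divide_le_eq) simp_all
    then have "B \<le> (- r0) * (\<gamma> * (\<beta> * q y))"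
      by (simp add: mult_ac)
    also have "\<dots> \<le> (- r0) * G y"
      using G[OF y] \<gamma> r0 by (intro mult_left_mono) (auto simp: q_def algebra_simps)
    also have "\<dots> \<le> (- r) * G y"
      using r Gpos[OF y] by (intro mult_right_mono) auto
    finally show ?thesis
      using bdd[OF y] by simp
  qed
  have "r < 0"
    using r r0 by simp
  then have wz_neg: "w z < 0"
    using wz Gpos[OF zS] by (simp add: mult_neg_pos)
  have inner: "a < z $ k" "z $ k < b"
    using zS wz_neg bottom[of z] top[of z] unfolding closed_slab_def by force+
  obtain L where L: "L \<le> - C * w z" "has_laplacian w z L"
    using lap[OF inner wz_neg] by blast
  obtain L' where L': "L' < - C * G z" "has_laplacian G z L'"
    using lapG[OF zS] by blast
  have "\<forall>\<^sub>F y in nhds z. r * G y \<le> w y"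
    using eventually_in_open_slab[OF inner]
    by eventually_elim (auto intro!: below simp: closed_slab_def)
  then have "r * L' \<le> L"
    using laplacian_le_of_touching_below[OF has_laplacian_cmult[OF L'(2)] L(2)] wz by blast
  moreover have "r * (- C * G z) < r * L'"
    using L'(1) \<open>r < 0\<close> by (rule mult_strict_left_mono_neg)
  ultimately show False
    using L(1) wz by (simp add: mult.left_commute)
qed

section \<open>Uniform bounds for solutions\<close>

text \<open>
  The square makes the bump a strict subsolution near the edge of its support: there the Laplacian is
  close to \<open>8 * R\<^sup>2\<close>, while the bump itself is close to \<open>0\<close>.
\<close>

lemma has_laplacian_bump:
  fixes x y :: "real ^ 'n::finite"
  shows "has_laplacian (\<lambda>z. (R\<^sup>2 - (norm (z - y))\<^sup>2)\<^sup>2) x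
           (8 * (norm (x - y))\<^sup>2 - 4 * real CARD('n) * (R\<^sup>2 - (norm (x - y))\<^sup>2))"
proof -
  define r where "r = R\<^sup>2 - (norm (x - y))\<^sup>2"
  define z where "z = x - y"
  have "has_second_partial i (\<lambda>z. (R\<^sup>2 - (norm (z - y))\<^sup>2)\<^sup>2) x (8 * (z $ i)\<^sup>2 - 4 * r)" for i
  proof (rule has_second_partialI)
    have eq: "(norm (x + s *\<^sub>R axis i 1 - y))\<^sup>2 = (norm z)\<^sup>2 + 2 * s * z $ i + s\<^sup>2" for s
      using norm_add_axis_sq[of z s i] by (simp add: z_def algebra_simps)
    show "((\<lambda>s. (R\<^sup>2 - (norm (x + s *\<^sub>R axis i 1 - y))\<^sup>2)\<^sup>2) has_real_derivative
            (-4) * (z $ i + t) * (r - 2 * t * z $ i - t\<^sup>2)) (at t)" for t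
      unfolding eq
      by (auto intro!: derivative_eq_intros simp: r_def z_def algebra_simps)
    show "((\<lambda>t. (-4) * (z $ i + t) * (r - 2 * t * z $ i - t\<^sup>2)) has_real_derivative
            8 * (z $ i)\<^sup>2 - 4 * r) (at 0)"
      by (auto intro!: derivative_eq_intros simp: power2_eq_square algebra_simps)
  qed
  moreover have "(norm z)\<^sup>2 = (\<Sum>i\<in>UNIV. (z $ i)\<^sup>2)"
    unfolding power2_norm_eq_inner by (simp add: inner_vec_def power2_eq_square)
  then have "8 * (norm z)\<^sup>2 - 4 * real CARD('n) * r = (\<Sum>i\<in>UNIV. 8 * (z $ i)\<^sup>2 - 4 * r)"
    by (simp add: sum_subtractf sum_distrib_left)
  ultimately show ?thesis
    unfolding has_laplacian_def r_def z_def
    by (intro exI[of _ "\<lambda>i. 8 * ((x - y) $ i)\<^sup>2 - 4 * (R\<^sup>2 - (norm (x - y))\<^sup>2)"] conjI allI)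
qed

text \<open>
  The hypotheses in the form in which the comparison arguments consume them: pointwise bounds on slabs,
  a Lipschitz constant for each compact interval of positive numbers, and the equation as a statement
  about \<open>has_laplacian\<close>.
\<close>

locale half_space_solution =
  fixes f :: "real \<Rightarrow> real" and u :: "real ^ 'n::finite \<Rightarrow> real" and k :: 'n
  assumes equation: "0 < x $ k \<Longrightarrow> has_laplacian u x (- f (u x))"
    and cont: "continuous_on {x. 0 \<le> x $ k} u"
    and pos: "0 < x $ k \<Longrightarrow> 0 < u x"
    and zero: "x $ k = 0 \<Longrightarrow> u x = 0"
    and bounded_on_slab: "\<exists>M. \<forall>x \<in> closed_slab k 0 l. u x \<le> M"
    and f_one_sided: "\<exists>C. \<forall>s t. 0 < t \<and> t \<le> s \<and> s \<le> M \<longrightarrow> f s - f t \<le> C * (s - t)"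
    and f_above_linear: "\<exists>c>0. \<exists>t0>0. \<forall>t. 0 < t \<and> t < t0 \<longrightarrow> c * t < f t"
    and f_lipschitz: "0 < a \<Longrightarrow> \<exists>L. \<forall>s\<in>{a..b}. \<forall>t\<in>{a..b}. \<bar>f s - f t\<bar> \<le> L * \<bar>s - t\<bar>"
begin

lemma nonneg: "0 \<le> x $ k \<Longrightarrow> 0 \<le> u x"
  using pos[of x] zero[of x] by (cases "x $ k = 0") auto

text \<open>
  The largest multiple of the bump \<open>\<phi>\<close> that fits under \<open>u\<close> touches \<open>u\<close> at some \<open>z\<close> inside the ball,
  because \<open>u\<close> is positive on the closed ball and \<open>\<phi>\<close> vanishes on its edge. The radius is so large that
  \<open>\<phi>\<close> satisfies \<open>laplacian \<phi> \<ge> - c * \<phi>\<close>; were \<open>u z < t0\<close>, then \<open>laplacian u z < - c * u z\<close>, which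
  is impossible at a touching point. Hence \<open>u z \<ge> t0\<close>, and the multiple is at least \<open>t0 / (R\<^sup>2)\<^sup>2\<close>,
  a bound that does not depend on the position of the ball.
\<close>

lemma bump_below:
  assumes c: "\<And>t. 0 < t \<Longrightarrow> t < t0 \<Longrightarrow> c * t < f t" and t0: "0 < t0"
    and R: "0 < R" "(4 * real CARD('n) + 8)\<^sup>2 \<le> 32 * c * R\<^sup>2"
    and y: "R < y $ k" and x: "norm (x - y) \<le> R"
  shows "t0 * (R\<^sup>2 - (norm (x - y))\<^sup>2)\<^sup>2 \<le> (R\<^sup>2)\<^sup>2 * u x"
proof -
  define \<phi> where "\<phi> z = (R\<^sup>2 - (norm (z - y))\<^sup>2)\<^sup>2" for z
  have height: "0 < z $ k" if "z \<in> cball y R" for z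
  proof -
    have "\<bar>(z - y) $ k\<bar> \<le> norm (z - y)"
      by (rule component_le_norm_cart)
    then show ?thesis
      using that y by (simp add: dist_norm norm_minus_commute)
  qed
  have "continuous_on (cball y R) (\<lambda>z. \<phi> z / u z)"
    unfolding \<phi>_def using height pos
    by (intro continuous_intros continuous_on_subset[OF cont]) (auto simp: less_imp_le less_imp_neq[symmetric])
  moreover have "cball y R \<noteq> {}"
    using R by simp
  ultimately obtain z where z: "z \<in> cball y R" "\<And>v. v \<in> cball y R \<Longrightarrow> \<phi> v / u v \<le> \<phi> z / u z"
    using continuous_attains_sup[OF compact_cball, of y R "\<lambda>z. \<phi> z / u z"] by blast
  define s where "s = \<phi> z / u z"
  have uz: "0 < u z"
    using height[OF z(1)] pos by blast
  have above: "\<phi> v \<le> s * u v" if "v \<in> cball y R" for v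
    using z(2)[OF that] pos[OF height[OF that]] by (simp add: s_def field_simps)
  have "0 < \<phi> y / u y"
    using R y pos[of y] by (simp add: \<phi>_def)
  then have s: "0 < s"
    using z(2)[of y] R by (simp add: s_def)
  define r where "r = R\<^sup>2 - (norm (z - y))\<^sup>2"
  have \<phi>z: "\<phi> z = r\<^sup>2" "s * u z = \<phi> z"
    using uz by (simp_all add: \<phi>_def r_def s_def)
  have "r \<noteq> 0"
    using \<phi>z s uz by auto
  moreover have "(norm (z - y))\<^sup>2 \<le> R\<^sup>2"
    using z(1) by (intro power_mono) (auto simp: dist_norm norm_minus_commute)
  ultimately have r: "0 < r"
    by (simp add: r_def)
  then have "(norm (z - y))\<^sup>2 < R\<^sup>2"
    by (simp add: r_def)
  then have "z \<in> ball y R"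
    using R(1) power2_less_imp_less[of "norm (z - y)" R] by (simp add: dist_norm norm_minus_commute)
  then have "\<forall>\<^sub>F v in nhds z. v \<in> ball y R"
    by (intro eventually_nhds_in_open) auto
  then have "\<forall>\<^sub>F v in nhds z. \<phi> v \<le> s * u v"
    by eventually_elim (auto intro: above)
  moreover have "has_laplacian \<phi> z (8 * (norm (z - y))\<^sup>2 - 4 * real CARD('n) * r)"
    unfolding \<phi>_def r_def by (rule has_laplacian_bump)
  ultimately have touch: "8 * (norm (z - y))\<^sup>2 - 4 * real CARD('n) * r \<le> s * (- f (u z))"
    using laplacian_le_of_touching_below has_laplacian_cmult[OF equation[OF height[OF z(1)]]] \<phi>z(2)
    by metis
  have "t0 \<le> u z"
  proof (rule ccontr)
    assume "\<not> t0 \<le> u z"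
    then have "s * (c * u z) < s * f (u z)"
      using c[OF uz] s by simp
    then have "c * r\<^sup>2 < s * f (u z)"
      using \<phi>z by (simp add: algebra_simps)
    then have less: "8 * R\<^sup>2 + c * r\<^sup>2 < (4 * real CARD('n) + 8) * r"
      using touch by (simp add: r_def algebra_simps)
    \<comment> \<open>The discriminant of \<open>8 * R\<^sup>2 - (4 * N + 8) * r + c * r\<^sup>2\<close> (\<open>N\<close> the dimension), as a quadratic in \<open>r\<close>,
        is not positive by the choice of \<open>R\<close>; completing the square avoids dividing by \<open>c\<close>.\<close>
    have "0 \<le> (16 * R\<^sup>2 - (4 * real CARD('n) + 8) * r)\<^sup>2"
      by simp
    also have "\<dots> = 256 * (R\<^sup>2)\<^sup>2 - 32 * R\<^sup>2 * ((4 * real CARD('n) + 8) * r) + (4 * real CARD('n) + 8)\<^sup>2 * r\<^sup>2"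
      by (simp add: power2_eq_square algebra_simps)
    also have "\<dots> \<le> 256 * (R\<^sup>2)\<^sup>2 - 32 * R\<^sup>2 * ((4 * real CARD('n) + 8) * r) + 32 * c * R\<^sup>2 * r\<^sup>2"
      using mult_right_mono[OF R(2), of "r\<^sup>2"] by simp
    also have "\<dots> = 32 * R\<^sup>2 * (8 * R\<^sup>2 + c * r\<^sup>2 - (4 * real CARD('n) + 8) * r)"
      by (simp add: power2_eq_square algebra_simps)
    also have "\<dots> < 0"
      using less R(1) by (intro mult_pos_neg) auto
    finally show False by simp
  qed
  have "r \<le> R\<^sup>2"
    by (simp add: r_def)
  then have "\<phi> z \<le> (R\<^sup>2)\<^sup>2"
    unfolding \<phi>z using r by (intro power_mono) auto
  have "t0 * s \<le> s * u z"
    using \<open>t0 \<le> u z\<close> s by simp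
  also have "\<dots> \<le> (R\<^sup>2)\<^sup>2"
    using \<phi>z \<open>\<phi> z \<le> (R\<^sup>2)\<^sup>2\<close> by simp
  finally have ts: "t0 * s \<le> (R\<^sup>2)\<^sup>2" .
  have xb: "x \<in> cball y R"
    using x by (simp add: dist_norm norm_minus_commute)
  have "t0 * \<phi> x \<le> t0 * (s * u x)"
    using above[OF xb] t0 by simp
  also have "\<dots> \<le> (R\<^sup>2)\<^sup>2 * u x"
    using mult_right_mono[OF ts, of "u x"] pos[OF height[OF xb]] by (simp add: mult.assoc)
  finally show ?thesis
    by (simp add: \<phi>_def)
qed

text \<open>
  A ball of radius \<open>R\<close> centred vertically above \<open>x\<close> (or at \<open>x\<close> itself, if \<open>x\<close> is high enough) lies in the
  half-space and has \<open>x\<close> at distance at most \<open>\<rho> < R\<close> from its centre.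
\<close>

lemma uniformly_positive:
  assumes a: "0 < a"
  shows "\<exists>c>0. \<forall>x. a \<le> x $ k \<longrightarrow> c \<le> u x"
proof -
  obtain c t0 where c: "0 < c" and t0: "0 < t0" and f: "\<And>t. 0 < t \<Longrightarrow> t < t0 \<Longrightarrow> c * t < f t"
    using f_above_linear by blast
  define N where "N = 4 * real CARD('n) + 8"
  define R where "R = N / sqrt (32 * c)"
  have N: "0 < N"
    by (simp add: N_def add_nonneg_pos)
  have R: "0 < R" "N\<^sup>2 \<le> 32 * c * R\<^sup>2"
    using N c by (simp_all add: R_def power_divide)
  define \<rho> where "\<rho> = max 0 (R - a / 2)"
  have \<rho>: "0 \<le> \<rho>" "\<rho> < R"
    using a R(1) by (auto simp: \<rho>_def)
  have \<rho>2: "\<rho>\<^sup>2 < R\<^sup>2"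
    using \<rho> by (intro power_strict_mono) auto
  show ?thesis
  proof (intro exI conjI allI impI)
    show "0 < t0 * (R\<^sup>2 - \<rho>\<^sup>2)\<^sup>2 / (R\<^sup>2)\<^sup>2"
      using t0 R(1) \<rho>2 by simp
    fix x :: "real ^ 'n" assume x: "a \<le> x $ k"
    define h where "h = max (x $ k) (R + a / 2) - x $ k"
    define y where "y = x + h *\<^sub>R axis k 1"
    have yk: "R < y $ k"
      using a by (auto simp: y_def h_def)
    have "norm (x - y) = h"
      by (simp add: y_def h_def)
    then have dist: "norm (x - y) \<le> \<rho>"
      using x by (auto simp: h_def \<rho>_def)
    then have "(norm (x - y))\<^sup>2 \<le> \<rho>\<^sup>2"
      by (intro power_mono) auto
    then have "(R\<^sup>2 - \<rho>\<^sup>2)\<^sup>2 \<le> (R\<^sup>2 - (norm (x - y))\<^sup>2)\<^sup>2"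
      using \<rho>2 by (intro power_mono) auto
    then have "t0 * (R\<^sup>2 - \<rho>\<^sup>2)\<^sup>2 \<le> t0 * (R\<^sup>2 - (norm (x - y))\<^sup>2)\<^sup>2"
      using t0 by simp
    also have "\<dots> \<le> (R\<^sup>2)\<^sup>2 * u x"
      using dist \<rho> R yk by (intro bump_below[OF f t0]) (auto simp: N_def)
    finally show "t0 * (R\<^sup>2 - \<rho>\<^sup>2)\<^sup>2 / (R\<^sup>2)\<^sup>2 \<le> u x"
      using R(1) by (simp add: field_simps)
  qed
qed

text \<open>
  At points where \<open>u\<close> exceeds \<open>t = \<epsilon> / 2\<close>, the one-sided Lipschitz condition bounds \<open>f (u x)\<close> by a constant
  \<open>K\<close>, however singular \<open>f\<close> is at \<open>0\<close>. So \<open>u\<close> cannot rise above the parabola \<open>\<psi>\<close>, which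
  stays above \<open>t\<close>, starts at \<open>t\<close> and has second derivative \<open>- K\<close>.
\<close>

lemma uniformly_small_near_boundary:
  assumes \<epsilon>: "0 < \<epsilon>"
  shows "\<exists>d>0. \<forall>x. 0 \<le> x $ k \<and> x $ k \<le> d \<longrightarrow> u x \<le> \<epsilon>"
proof -
  obtain M where M: "\<And>x. x \<in> closed_slab k 0 1 \<Longrightarrow> u x \<le> M"
    using bounded_on_slab[of 1] by blast
  obtain C where C: "\<And>s t. 0 < t \<Longrightarrow> t \<le> s \<Longrightarrow> s \<le> M \<Longrightarrow> f s - f t \<le> C * (s - t)"
    using f_one_sided[of M] by blast
  define t where "t = \<epsilon> / 2"
  have t: "0 < t"
    using \<epsilon> by (simp add: t_def)
  define K where "K = \<bar>f t\<bar> + \<bar>C\<bar> * \<bar>M\<bar>"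
  define A where "A = K / 2 + \<bar>M\<bar>"
  have K: "0 \<le> K" "0 \<le> A"
    by (auto simp: K_def A_def)
  define \<psi> where "\<psi> h = t + A * h - K / 2 * h\<^sup>2" for h
  have \<psi>: "t \<le> \<psi> h" if "0 \<le> h" "h \<le> 1" for h
  proof -
    have "K / 2 * h\<^sup>2 \<le> K / 2 * (1 * h)"
      unfolding power2_eq_square using that K by (intro mult_left_mono mult_right_mono) auto
    also have "\<dots> = K / 2 * h"
      by simp
    also have "\<dots> \<le> A * h"
      using that by (intro mult_right_mono) (auto simp: A_def)
    finally show ?thesis
      by (simp add: \<psi>_def)
  qed
  have below: "u x \<le> \<psi> (x $ k)" if x: "x \<in> closed_slab k 0 1" for x
  proof -
    have "0 \<le> \<psi> (x $ k) - u x"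
    proof (rule slab_comparison[where a = 0 and b = 1 and C = 0 and B = M and w = "\<lambda>x. \<psi> (x $ k) - u x", OF _ _ _ _ _ _ _ x])
      show "continuous_on (closed_slab k 0 1) (\<lambda>x. \<psi> (x $ k) - u x)"
        unfolding \<psi>_def by (intro continuous_intros continuous_on_subset[OF cont]) (auto simp: closed_slab_def)
      show "- M \<le> \<psi> (x $ k) - u x" if "x \<in> closed_slab k 0 1" for x
        using \<psi>[of "x $ k"] M[OF that] t that by (auto simp: closed_slab_def)
      show "0 \<le> \<psi> (x $ k) - u x" if "x $ k = 0" for x
        using that zero[OF that] t by (simp add: \<psi>_def)
      show "0 \<le> \<psi> (x $ k) - u x" if "x $ k = 1" for x
        using that M[of x] t by (simp add: \<psi>_def A_def closed_slab_def)
      show "\<exists>L\<le>- 0 * (\<psi> (x $ k) - u x). has_laplacian (\<lambda>x. \<psi> (x $ k) - u x) x L"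
        if h: "0 < x $ k" "x $ k < 1" and neg: "\<psi> (x $ k) - u x < 0" for x
      proof (intro exI conjI)
        have "has_laplacian (\<lambda>y. \<psi> (y $ k)) x (- K)"
          unfolding \<psi>_def
          by (rule has_laplacian_height[where g' = "\<lambda>h. A - K * h"]) (auto intro!: derivative_eq_intros)
        then show "has_laplacian (\<lambda>x. \<psi> (x $ k) - u x) x (- K - (- f (u x)))"
          by (rule has_laplacian_diff[OF _ equation[OF h(1)]])
        have tu: "t \<le> u x" "u x \<le> M"
          using \<psi>[of "x $ k"] neg h M[of x] by (auto simp: closed_slab_def)
        have "f (u x) - f t \<le> C * (u x - t)"
          by (rule C[OF t tu])
        also have "\<dots> \<le> \<bar>C\<bar> * \<bar>M\<bar>"
          using tu t by (intro mult_mono) auto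
        finally show "- K - (- f (u x)) \<le> - 0 * (\<psi> (x $ k) - u x)"
          by (simp add: K_def)
      qed
    qed (use pi_gt_zero in auto)
    then show ?thesis by simp
  qed
  define d where "d = min 1 (t / (A + 1))"
  show ?thesis
  proof (intro exI conjI allI impI)
    show "0 < d"
      using t K by (simp add: d_def)
    fix x :: "real ^ 'n" assume x: "0 \<le> x $ k \<and> x $ k \<le> d"
    then have "u x \<le> \<psi> (x $ k)"
      by (intro below) (auto simp: closed_slab_def d_def)
    also have "\<dots> \<le> t + A * (x $ k)"
      using K by (simp add: \<psi>_def)
    also have "A * (x $ k) \<le> A * (t / (A + 1))"
      using x K by (intro mult_left_mono) (auto simp: d_def)
    also have "\<dots> \<le> t"
      using t K by (simp add: field_simps)
    finally show "u x \<le> \<epsilon>"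
      by (simp add: t_def)
  qed
qed

lemma has_laplacian_reflection_gap:
  assumes "0 < x $ k" "x $ k < 2 * l"
  shows "has_laplacian (\<lambda>y. u (reflect k l y) - u y) x (f (u x) - f (u (reflect k l x)))"
  using has_laplacian_diff[OF has_laplacian_reflect[OF equation[of "reflect k l x"]] equation[of x]] assms
  by simp

lemma continuous_on_reflection_gap:
  assumes "0 \<le> a" "b \<le> 2 * l"
  shows "continuous_on (closed_slab k a b) (\<lambda>y. u (reflect k l y) - u y)"
proof (intro continuous_on_diff)
  show "continuous_on (closed_slab k a b) (\<lambda>y. u (reflect k l y))"
    using assms
    by (intro continuous_on_compose2[OF cont] continuous_intros) (auto simp: closed_slab_def)
  show "continuous_on (closed_slab k a b) u"
    using assms by (intro continuous_on_subset[OF cont]) (auto simp: closed_slab_def)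
qed

text \<open>
  At heights bounded and bounded away from \<open>0\<close>, \<open>f (u x)\<close> is bounded by some \<open>K\<close>, so the gap of the
  reflection in the plane at height \<open>m\<close> has Laplacian at most \<open>2 * K\<close>. It vanishes on the plane and
  is at least \<open>- M\<close> at distance \<open>d\<close> below it, so it stays above the parabola \<open>- \<psi>\<close> in the distance to
  the plane. Being an estimate in slabs, this replaces an interior gradient bound.
\<close>

lemma vertical_one_sided_lipschitz:
  assumes a: "0 < a"
  shows "\<exists>A\<ge>0. \<exists>d>0. \<forall>m y. a \<le> m \<and> m \<le> b \<and> y \<in> closed_slab k (m - d) m \<longrightarrow>
           u y - A * (m - y $ k) \<le> u (reflect k m y)"
proof -
  define d where "d = a / 2"
  have d: "0 < d"
    using a by (simp add: d_def)
  obtain c where c: "0 < c" "\<And>x. d \<le> x $ k \<Longrightarrow> c \<le> u x"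
    using uniformly_positive[OF d] by blast
  obtain M0 where M0: "\<And>x. x \<in> closed_slab k 0 (b + d) \<Longrightarrow> u x \<le> M0"
    using bounded_on_slab[of "b + d"] by blast
  define M where "M = max M0 c"
  have M: "c \<le> M" "\<And>x. x \<in> closed_slab k 0 (b + d) \<Longrightarrow> u x \<le> M"
    using M0 by (auto simp: M_def intro: max.coboundedI1)
  obtain L where L: "\<And>s t. s \<in> {c..M} \<Longrightarrow> t \<in> {c..M} \<Longrightarrow> \<bar>f s - f t\<bar> \<le> L * \<bar>s - t\<bar>"
    using f_lipschitz[OF c(1), of M] by blast
  define K where "K = \<bar>f c\<bar> + \<bar>L\<bar> * (M - c)"
  have K: "0 \<le> K"
    using M(1) by (simp add: K_def)
  have fK: "\<bar>f t\<bar> \<le> K" if "t \<in> {c..M}" for t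
  proof -
    have "\<bar>f t - f c\<bar> \<le> L * \<bar>t - c\<bar>"
      using that M(1) by (intro L) auto
    also have "\<dots> \<le> \<bar>L\<bar> * (M - c)"
      using that by (intro mult_mono) auto
    finally show ?thesis
      by (simp add: K_def)
  qed
  \<comment> \<open>Chosen so that \<open>\<psi> d = M\<close> for the parabola \<open>\<psi>\<close> below.\<close>
  define A where "A = K * d + M / d"
  have A: "0 \<le> A"
    using K d M(1) c(1) by (simp add: A_def)
  define \<psi> where "\<psi> r = A * r - K * r\<^sup>2" for r
  have \<psi>: "0 \<le> \<psi> r" if "0 \<le> r" "r \<le> d" for r
  proof -
    have "K * r \<le> K * d"
      using that K by (intro mult_left_mono) auto
    also have "\<dots> \<le> A"
      using M(1) c(1) d by (simp add: A_def)
    finally have "0 \<le> r * (A - K * r)"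
      using that by simp
    then show ?thesis
      by (simp add: \<psi>_def power2_eq_square algebra_simps)
  qed
  have "u y - A * (m - y $ k) \<le> u (reflect k m y)"
    if m: "a \<le> m" "m \<le> b" and y: "y \<in> closed_slab k (m - d) m" for m y
  proof -
    have h: "d \<le> v $ k" "v $ k \<le> b" "d \<le> reflect k m v $ k" "reflect k m v $ k \<le> b + d"
      if "v \<in> closed_slab k (m - d) m" for v
      using that m d by (auto simp: closed_slab_def d_def)
    have range: "u v \<in> {c..M}" "u (reflect k m v) \<in> {c..M}" if "v \<in> closed_slab k (m - d) m" for v
      using c(2)[of v] c(2)[of "reflect k m v"] M(2)[of v] M(2)[of "reflect k m v"] h[OF that] d
      by (auto simp: closed_slab_def)
    define z where "z v = (u (reflect k m v) - u v) + \<psi> (m - v $ k)" for v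
    have "0 \<le> z y"
    proof (rule slab_comparison[where a = "m - d" and b = m and C = 0 and B = M
          and w = z, OF _ _ _ _ _ _ _ y])
      show "continuous_on (closed_slab k (m - d) m) z"
        unfolding z_def \<psi>_def using d m a
        by (intro continuous_on_add[OF continuous_on_reflection_gap] continuous_intros)
          (auto simp: d_def)
      show "- M \<le> z v" if "v \<in> closed_slab k (m - d) m" for v
        using range[OF that] \<psi>[of "m - v $ k"] that c(1) by (auto simp: z_def closed_slab_def)
      show "0 \<le> z v" if "v $ k = m - d" for v
      proof -
        have "\<psi> d = M"
          using d by (simp add: \<psi>_def A_def power2_eq_square algebra_simps)
        then show ?thesis
          using range[of v] that d c(1) by (auto simp: z_def closed_slab_def)
      qed
      show "0 \<le> z v" if "v $ k = m" for v
        using that by (simp add: z_def \<psi>_def reflect_fixed)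
      show "\<exists>L\<le>- 0 * z v. has_laplacian z v L" if v: "m - d < v $ k" "v $ k < m" for v
      proof (intro exI conjI)
        have vS: "v \<in> closed_slab k (m - d) m"
          using v by (simp add: closed_slab_def)
        have "has_laplacian (\<lambda>v. \<psi> (m - v $ k)) v (- 2 * K)"
          unfolding \<psi>_def
          by (rule has_laplacian_height[where g = "\<lambda>t. A * (m - t) - K * (m - t)\<^sup>2"
                and g' = "\<lambda>t. - A + 2 * K * (m - t)"])
            (auto intro!: derivative_eq_intros simp: algebra_simps)
        then show "has_laplacian z v (f (u v) - f (u (reflect k m v)) + (- 2 * K))"
          unfolding z_def using h[OF vS] v d
          by (intro has_laplacian_add[OF has_laplacian_reflection_gap]) auto
        show "f (u v) - f (u (reflect k m v)) + (- 2 * K) \<le> - 0 * z v"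
          using fK[OF range(1)[OF vS]] fK[OF range(2)[OF vS]] by simp
      qed
    qed (use d in auto)
    moreover have "\<psi> (m - y $ k) \<le> A * (m - y $ k)"
      using K by (simp add: \<psi>_def)
    ultimately show ?thesis
      by (simp add: z_def)
  qed
  then show ?thesis
    using A d by blast
qed

section \<open>Moving the plane\<close>

definition below_reflection :: "real \<Rightarrow> bool" where
  "below_reflection l \<longleftrightarrow> (\<forall>x \<in> closed_slab k 0 l. u x \<le> u (reflect k l x))"

text \<open>
  Where the gap is negative, both \<open>u x\<close> and its reflected value are positive and the one-sided Lipschitz
  condition gives \<open>laplacian w \<le> - D * w\<close>, which in a slab of width at most \<open>1 / D\<close> forces \<open>w \<ge> 0\<close>.
  Only the lower face needs attention, since the gap vanishes on the plane of reflection.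
\<close>

lemma below_reflection_narrow:
  "\<exists>d>0. \<forall>a l. 0 \<le> a \<and> a < l \<and> l \<le> \<Lambda> \<and> l - a \<le> d \<and>
       (\<forall>x. x $ k = a \<longrightarrow> u x \<le> u (reflect k l x)) \<longrightarrow>
       (\<forall>x \<in> closed_slab k a l. u x \<le> u (reflect k l x))"
proof -
  obtain M where M: "\<And>x. x \<in> closed_slab k 0 \<Lambda> \<Longrightarrow> u x \<le> M"
    using bounded_on_slab[of \<Lambda>] by blast
  obtain C where C: "\<And>s t. 0 < t \<Longrightarrow> t \<le> s \<Longrightarrow> s \<le> M \<Longrightarrow> f s - f t \<le> C * (s - t)"
    using f_one_sided[of M] by blast
  define D where "D = max C 1"
  have D: "1 \<le> D" "C \<le> D"
    by (auto simp: D_def)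
  show ?thesis
  proof (intro exI conjI allI impI ballI)
    show "0 < 1 / D"
      using D by simp
    fix a l x
    assume asm: "0 \<le> a \<and> a < l \<and> l \<le> \<Lambda> \<and> l - a \<le> 1 / D \<and>
        (\<forall>x. x $ k = a \<longrightarrow> u x \<le> u (reflect k l x))"
      and x: "x \<in> closed_slab k a l"
    have "0 \<le> u (reflect k l x) - u x"
    proof (rule slab_comparison[where a = a and b = l and C = D and B = M
          and w = "\<lambda>y. u (reflect k l y) - u y", OF _ _ _ _ _ _ _ x])
      have "D * (l - a)\<^sup>2 \<le> D * (1 / D)\<^sup>2"
        using asm D by (intro mult_left_mono power_mono) auto
      also have "\<dots> = 1 / D"
        using D by (simp add: power2_eq_square)
      also have "\<dots> \<le> 1"
        using D by simp
      also have "1 < pi\<^sup>2"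
        using pi_gt3 by (intro one_less_power) auto
      finally show "D * (l - a)\<^sup>2 < pi\<^sup>2" .
      show "continuous_on (closed_slab k a l) (\<lambda>y. u (reflect k l y) - u y)"
        using asm by (intro continuous_on_reflection_gap) auto
      show "- M \<le> u (reflect k l y) - u y" if "y \<in> closed_slab k a l" for y
        using that asm M[of y] nonneg[of "reflect k l y"] by (auto simp: closed_slab_def)
      show "\<exists>L\<le>- D * (u (reflect k l y) - u y). has_laplacian (\<lambda>y. u (reflect k l y) - u y) y L"
        if y: "a < y $ k" "y $ k < l" and neg: "u (reflect k l y) - u y < 0" for y
      proof (intro exI conjI)
        show "has_laplacian (\<lambda>y. u (reflect k l y) - u y) y (f (u y) - f (u (reflect k l y)))"
          using y asm by (intro has_laplacian_reflection_gap) auto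
        have "f (u y) - f (u (reflect k l y)) \<le> C * (u y - u (reflect k l y))"
          using y asm neg by (intro C pos M) (auto simp: closed_slab_def)
        also have "\<dots> \<le> D * (u y - u (reflect k l y))"
          using D neg by (intro mult_right_mono) auto
        finally show "f (u y) - f (u (reflect k l y)) \<le> - D * (u (reflect k l y) - u y)"
          by (simp add: algebra_simps)
      qed
    qed (use asm in \<open>auto simp: reflect_fixed\<close>)
    then show "u x \<le> u (reflect k l x)"
      by simp
  qed
qed

lemma below_reflection_small: "\<exists>d>0. \<forall>l. 0 < l \<and> l \<le> d \<longrightarrow> below_reflection l"
proof -
  obtain d where d: "0 < d" and narrow: "\<And>a l. 0 \<le> a \<Longrightarrow> a < l \<Longrightarrow> l \<le> 1 \<Longrightarrow> l - a \<le> d \<Longrightarrow>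
      (\<And>x. x $ k = a \<Longrightarrow> u x \<le> u (reflect k l x)) \<Longrightarrow>
      (\<forall>x \<in> closed_slab k a l. u x \<le> u (reflect k l x))"
    using below_reflection_narrow[of 1] by blast
  have "below_reflection l" if "0 < l" "l \<le> min d 1" for l
    unfolding below_reflection_def using that zero nonneg by (intro narrow) auto
  moreover have "0 < min d 1"
    using d by simp
  ultimately show ?thesis by blast
qed

text \<open>
  Near the boundary the gap is bounded below because \<open>u\<close> is uniformly small there and uniformly
  positive at the reflected points. Above the layer \<open>x $ k \<le> d0\<close> the values of \<open>u\<close> stay in a compact
  interval on which \<open>f\<close> is Lipschitz, so the gap is a supersolution of \<open>laplacian w = L * w\<close> and lies
  above the barrier \<open>h\<close>, a function of the distance to the plane which is convex and therefore
  dominates a linear function.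
\<close>

lemma reflection_gap_linear:
  assumes l: "0 < l" and below: "below_reflection l"
  shows "\<exists>\<kappa>>0. \<forall>x \<in> closed_slab k 0 l. \<kappa> * (l - x $ k) \<le> u (reflect k l x) - u x"
proof -
  define w where "w y = u (reflect k l y) - u y" for y
  have w: "0 \<le> w y" if "y \<in> closed_slab k 0 l" for y
    using below that by (simp add: below_reflection_def w_def)
  obtain c where c: "0 < c" "\<And>x. l \<le> x $ k \<Longrightarrow> c \<le> u x"
    using uniformly_positive[OF l] by blast
  obtain d where d: "0 < d" "\<And>x. 0 \<le> x $ k \<Longrightarrow> x $ k \<le> d \<Longrightarrow> u x \<le> c / 2"
    using uniformly_small_near_boundary[of "c / 2"] c(1) by auto
  define d0 where "d0 = min d (l / 2)"
  have d0: "0 < d0" "d0 < l" "d0 \<le> d"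
    using d(1) l by (auto simp: d0_def)
  have low: "c / 2 \<le> w y" if "0 \<le> y $ k" "y $ k \<le> d0" for y
    using c(2)[of "reflect k l y"] d(2)[of y] that d0 by (simp add: w_def)
  obtain c1 where c1: "0 < c1" "\<And>x. d0 \<le> x $ k \<Longrightarrow> c1 \<le> u x"
    using uniformly_positive[OF d0(1)] by blast
  obtain M where M: "\<And>x. x \<in> closed_slab k 0 (2 * l) \<Longrightarrow> u x \<le> M"
    using bounded_on_slab[of "2 * l"] by blast
  obtain L0 where L0: "\<And>s t. s \<in> {c1..M} \<Longrightarrow> t \<in> {c1..M} \<Longrightarrow> \<bar>f s - f t\<bar> \<le> L0 * \<bar>s - t\<bar>"
    using f_lipschitz[OF c1(1), of M] by blast
  define L where "L = max 1 L0"
  have L: "1 \<le> L" "L0 \<le> L"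
    by (auto simp: L_def)
  \<comment> \<open>Small enough that \<open>h\<close> stays below \<open>c / 2\<close>, the lower bound for the gap at height \<open>d0\<close>.\<close>
  define A where "A = c / 2 / exp (L * l)"
  have A: "0 < A"
    using c(1) by (simp add: A_def)
  define h where "h r = A * (exp (L * r) - 1)" for r
  have h: "h r \<le> c / 2" if "r \<le> l" for r
  proof -
    have "A * (exp (L * r) - 1) \<le> A * exp (L * l)"
      using A that L by (intro mult_left_mono) (auto intro: order_trans[of _ "exp (L * r)"])
    then show ?thesis
      by (simp add: h_def A_def)
  qed
  have above: "h (l - x $ k) \<le> w x" if x: "x \<in> closed_slab k d0 l" for x
  proof -
    have "0 \<le> w x - h (l - x $ k)"
    proof (rule slab_comparison[where a = d0 and b = l and C = 0 and B = "c / 2"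
          and w = "\<lambda>y. w y - h (l - y $ k)", OF _ _ _ _ _ _ _ x])
      show "continuous_on (closed_slab k d0 l) (\<lambda>y. w y - h (l - y $ k))"
        unfolding w_def h_def using d0 l
        by (intro continuous_on_diff[OF continuous_on_reflection_gap] continuous_intros) auto
      show "- (c / 2) \<le> w y - h (l - y $ k)" if "y \<in> closed_slab k d0 l" for y
        using that w[of y] h[of "l - y $ k"] d0 by (auto simp: closed_slab_def)
      show "0 \<le> w y - h (l - y $ k)" if "y $ k = d0" for y
        using that low[of y] h[of "l - y $ k"] d0 by simp
      show "0 \<le> w y - h (l - y $ k)" if "y $ k = l" for y
        using that by (simp add: w_def h_def reflect_fixed)
      show "\<exists>L'\<le>- 0 * (w y - h (l - y $ k)). has_laplacian (\<lambda>y. w y - h (l - y $ k)) y L'"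
        if y: "d0 < y $ k" "y $ k < l" and neg: "w y - h (l - y $ k) < 0" for y
      proof (intro exI conjI)
        let ?e = "A * exp (L * (l - y $ k))"
        have "has_laplacian (\<lambda>y. h (l - y $ k)) y (L\<^sup>2 * ?e)"
          unfolding h_def
          by (rule has_laplacian_height[where g = "\<lambda>t. A * (exp (L * (l - t)) - 1)"
                and g' = "\<lambda>t. - L * (A * exp (L * (l - t)))"])
            (auto intro!: derivative_eq_intros simp: power2_eq_square)
        then show "has_laplacian (\<lambda>y. w y - h (l - y $ k)) y
            (f (u y) - f (u (reflect k l y)) - L\<^sup>2 * ?e)"
          unfolding w_def using y d0
          by (intro has_laplacian_diff[OF has_laplacian_reflection_gap]) auto
        have range: "u y \<in> {c1..M}" "u (reflect k l y) \<in> {c1..M}"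
          using c1(2)[of y] c1(2)[of "reflect k l y"] M[of y] M[of "reflect k l y"] y d0
          by (auto simp: closed_slab_def)
        have "0 \<le> w y"
          using w y d0 by (simp add: closed_slab_def)
        have "f (u y) - f (u (reflect k l y)) \<le> L0 * \<bar>u y - u (reflect k l y)\<bar>"
          using L0[OF range] by simp
        also have "\<dots> = L0 * w y"
          using \<open>0 \<le> w y\<close> by (simp add: w_def)
        also have "\<dots> \<le> L * w y"
          using \<open>0 \<le> w y\<close> L by (intro mult_right_mono) auto
        also have "\<dots> \<le> L * ?e"
          using neg A L by (intro mult_left_mono) (auto simp: h_def algebra_simps)
        also have "\<dots> \<le> L\<^sup>2 * ?e"
          using L A by (intro mult_right_mono self_le_power) auto
        finally show "f (u y) - f (u (reflect k l y)) - L\<^sup>2 * ?e \<le> - 0 * (w y - h (l - y $ k))"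
          by simp
      qed
    qed (use d0 in auto)
    then show ?thesis by simp
  qed
  define \<kappa> where "\<kappa> = min (A * L) (c / (2 * l))"
  show ?thesis
  proof (intro exI conjI ballI)
    show "0 < \<kappa>"
      using A L c l by (simp add: \<kappa>_def)
    fix x assume x: "x \<in> closed_slab k 0 l"
    then have r: "0 \<le> l - x $ k" "l - x $ k \<le> l" "0 \<le> x $ k"
      by (auto simp: closed_slab_def)
    have "\<kappa> * (l - x $ k) \<le> w x"
    proof (cases "x $ k \<le> d0")
      case True
      have "\<kappa> * (l - x $ k) \<le> c / (2 * l) * l"
        using r l c by (intro mult_mono) (auto simp: \<kappa>_def)
      also have "\<dots> \<le> w x"
        using low[of x] True r l by simp
      finally show ?thesis .
    next
      case False
      have "\<kappa> * (l - x $ k) \<le> A * L * (l - x $ k)"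
        using r by (intro mult_right_mono) (auto simp: \<kappa>_def)
      also have "\<dots> = A * (L * (l - x $ k))"
        by simp
      also have "\<dots> \<le> h (l - x $ k)"
        unfolding h_def using A exp_ge_add_one_self[of "L * (l - x $ k)"]
        by (intro mult_left_mono) linarith+
      also have "\<dots> \<le> w x"
        using False x by (intro above) (auto simp: closed_slab_def)
      finally show ?thesis .
    qed
    then show "\<kappa> * (l - x $ k) \<le> u (reflect k l x) - u x"
      by (simp add: w_def)
  qed
qed

text \<open>
  Moving the plane from \<open>l\<close> to \<open>m\<close> shifts the reflected point by twice \<open>m - l\<close>, that is, reflects
  it once more in the plane at height \<open>n = l + m - x $ k\<close>. The loss is of order \<open>m - l\<close>, less than the
  linear gap as long as \<open>x\<close> is at distance \<open>\<delta>\<close> from the plane; the remaining layer is narrow.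
\<close>

lemma below_reflection_open:
  assumes l: "0 < l" and below: "below_reflection l"
  shows "\<exists>\<eta>>0. \<forall>m. l \<le> m \<and> m \<le> l + \<eta> \<longrightarrow> below_reflection m"
proof -
  obtain \<kappa> where \<kappa>: "0 < \<kappa>"
    "\<And>x. x \<in> closed_slab k 0 l \<Longrightarrow> \<kappa> * (l - x $ k) \<le> u (reflect k l x) - u x"
    using reflection_gap_linear[OF l below] by blast
  obtain d where d: "0 < d" and narrow: "\<And>a m. 0 \<le> a \<Longrightarrow> a < m \<Longrightarrow> m \<le> l + 1 \<Longrightarrow> m - a \<le> d \<Longrightarrow>
      (\<And>x. x $ k = a \<Longrightarrow> u x \<le> u (reflect k m x)) \<Longrightarrow>
      (\<forall>x \<in> closed_slab k a m. u x \<le> u (reflect k m x))"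
    using below_reflection_narrow[of "l + 1"] by blast
  obtain A d' where A: "0 \<le> A" and d': "0 < d'"
    and lip: "\<And>m y. l \<le> m \<Longrightarrow> m \<le> 2 * l + 1 \<Longrightarrow> y \<in> closed_slab k (m - d') m \<Longrightarrow>
        u y - A * (m - y $ k) \<le> u (reflect k m y)"
    using vertical_one_sided_lipschitz[OF l, of "2 * l + 1"] by blast
  define \<delta> where "\<delta> = min (d / 2) (l / 2)"
  have \<delta>: "0 < \<delta>" "\<delta> < l" "\<delta> \<le> d / 2"
    using d l by (auto simp: \<delta>_def)
  define \<eta> where "\<eta> = Min {1, d / 2, d', \<kappa> * \<delta> / (A + 1)}"
  have \<eta>: "0 < \<eta>" "\<eta> \<le> 1" "\<eta> \<le> d / 2" "\<eta> \<le> d'" "\<eta> \<le> \<kappa> * \<delta> / (A + 1)"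
    using d d' \<kappa>(1) \<delta>(1) A unfolding \<eta>_def by (simp, (intro Min_le; simp)+)
  have "A * \<eta> \<le> (A + 1) * \<eta>"
    using \<eta>(1) by simp
  also have "\<dots> \<le> \<kappa> * \<delta>"
    using \<eta>(5) A by (simp add: field_simps)
  finally have A\<eta>: "A * \<eta> \<le> \<kappa> * \<delta>" .
  have "below_reflection m" if m: "l \<le> m" "m \<le> l + \<eta>" for m
  proof -
    have middle: "u x \<le> u (reflect k m x)" if x: "0 \<le> x $ k" "x $ k \<le> l - \<delta>" for x
    proof -
      have "\<kappa> * \<delta> \<le> \<kappa> * (l - x $ k)"
        using x \<kappa>(1) by simp
      also have "\<dots> \<le> u (reflect k l x) - u x"
        using x \<delta> by (intro \<kappa>(2)) (simp add: closed_slab_def)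
      finally have gap: "\<kappa> * \<delta> \<le> u (reflect k l x) - u x" .
      define n where "n = l + m - x $ k"
      have refl: "reflect k n (reflect k l x) = reflect k m x"
        by (simp add: reflect_def n_def algebra_simps flip: scaleR_add_left)
      have "u (reflect k l x) - A * (n - reflect k l x $ k) \<le> u (reflect k n (reflect k l x))"
        using m x \<delta> \<eta> by (intro lip) (auto simp: n_def closed_slab_def)
      then have "u (reflect k l x) - A * (m - l) \<le> u (reflect k m x)"
        unfolding refl by (simp add: n_def)
      moreover have "A * (m - l) \<le> A * \<eta>"
        using m A by (intro mult_left_mono) auto
      ultimately show ?thesis
        using gap A\<eta> by linarith
    qed
    have "\<forall>x \<in> closed_slab k (l - \<delta>) m. u x \<le> u (reflect k m x)"
      using m \<delta> \<eta> middle by (intro narrow) auto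
    with middle show ?thesis
      unfolding below_reflection_def by (fastforce simp: closed_slab_def)
  qed
  then show ?thesis
    using \<eta>(1) by blast
qed

lemma below_reflection_closed:
  assumes l: "0 < l" and below: "\<And>m. 0 < m \<Longrightarrow> m < l \<Longrightarrow> below_reflection m"
  shows "below_reflection l"
  unfolding below_reflection_def
proof
  fix x assume x: "x \<in> closed_slab k 0 l"
  show "u x \<le> u (reflect k l x)"
  proof (cases "x $ k = l")
    case True
    then show ?thesis by (simp add: reflect_fixed)
  next
    case False
    with x have xk: "0 \<le> x $ k" "x $ k < l"
      by (auto simp: closed_slab_def)
    have "continuous_on {x $ k..l} (\<lambda>m. u (reflect k m x))"
      unfolding reflect_def using xk
      by (intro continuous_on_compose2[OF cont] continuous_intros) auto
    then have lim: "((\<lambda>m. u (reflect k m x)) \<longlongrightarrow> u (reflect k l x)) (at_left l)"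
      using xk by (intro continuous_on_Icc_at_leftD) auto
    have "\<forall>\<^sub>F m in at_left l. u x \<le> u (reflect k m x)"
      using eventually_at_left_real[OF xk(2)]
    proof eventually_elim
      case (elim m)
      then show ?case
        using below[of m] xk by (auto simp: below_reflection_def closed_slab_def)
    qed
    then show ?thesis
      by (intro tendsto_lowerbound[OF lim]) auto
  qed
qed

lemma below_reflection_all:
  assumes "0 < l"
  shows "below_reflection l"
proof (rule ccontr)
  assume not_below: "\<not> below_reflection l"
  define B where "B = {m. 0 < m \<and> \<not> below_reflection m}"
  define s where "s = Inf B"
  have ne: "B \<noteq> {}"
    using not_below assms by (auto simp: B_def)
  have bdd: "bdd_below B"
    by (intro bdd_belowI[of _ 0]) (auto simp: B_def)
  obtain d where d: "0 < d" "\<And>m. 0 < m \<Longrightarrow> m \<le> d \<Longrightarrow> below_reflection m"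
    using below_reflection_small by blast
  have "d \<le> s"
    unfolding s_def using d ne by (intro cInf_greatest) (force simp: B_def)+
  then have s: "0 < s"
    using d by simp
  have "below_reflection m" if "0 < m" "m < s" for m
    using that cInf_lower[OF _ bdd, of m] by (force simp: B_def s_def)
  then have "below_reflection s"
    by (rule below_reflection_closed[OF s])
  then obtain \<eta> where \<eta>: "0 < \<eta>" "\<And>m. s \<le> m \<Longrightarrow> m \<le> s + \<eta> \<Longrightarrow> below_reflection m"
    using below_reflection_open[OF s] by blast
  have "s + \<eta> \<le> m" if m: "m \<in> B" for m
  proof (rule ccontr)
    assume "\<not> s + \<eta> \<le> m"
    moreover have "s \<le> m"
      unfolding s_def by (rule cInf_lower[OF m bdd])
    ultimately show False
      using \<eta>(2)[of m] m by (simp add: B_def)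
  qed
  then have "s + \<eta> \<le> s"
    unfolding s_def using ne by (intro cInf_greatest) (auto simp: s_def)
  then show False
    using \<eta>(1) by simp
qed

text \<open>
  Reflection in the plane through \<open>x\<close> exchanges the two points compared here, so this is the linear gap.
\<close>

lemma vertical_increment:
  assumes x: "0 < x $ k"
  shows "\<exists>\<kappa>>0. \<forall>s. 0 \<le> s \<and> s \<le> x $ k \<longrightarrow>
           \<kappa> * s \<le> u (x + s *\<^sub>R axis k 1) - u (x - s *\<^sub>R axis k 1)"
proof -
  obtain \<kappa> where \<kappa>: "0 < \<kappa>" "\<And>y. y \<in> closed_slab k 0 (x $ k) \<Longrightarrow>
      \<kappa> * (x $ k - y $ k) \<le> u (reflect k (x $ k) y) - u y"
    using reflection_gap_linear[OF x below_reflection_all[OF x]] by blast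
  have "\<kappa> * s \<le> u (x + s *\<^sub>R axis k 1) - u (x - s *\<^sub>R axis k 1)" if "0 \<le> s" "s \<le> x $ k" for s
  proof -
    have refl: "reflect k (x $ k) (x - s *\<^sub>R axis k 1) = x + s *\<^sub>R axis k 1"
      by (simp add: reflect_def algebra_simps flip: scaleR_add_left)
    show ?thesis
      using \<kappa>(2)[of "x - s *\<^sub>R axis k 1"] that unfolding refl by (simp add: closed_slab_def)
  qed
  then show ?thesis
    using \<kappa>(1) by blast
qed

end

section \<open>From the classical formulation to the estimates\<close>

lemma has_second_partial_of_has_partial:
  assumes S: "open S" "x \<in> S" and u: "\<And>y. y \<in> S \<Longrightarrow> has_partial_at i u y"
    and pu: "has_partial_at i (partial i u) x"
  shows "has_second_partial i u x (partial i (partial i u) x)"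
proof -
  have deriv: "((\<lambda>s. v (y + s *\<^sub>R axis i 1)) has_real_derivative partial i v y) (at 0)"
    if "has_partial_at i v y" for v y
    using that unfolding has_partial_at_def partial_def DERIV_deriv_iff_real_differentiable .
  have lim: "((\<lambda>s. x + s *\<^sub>R axis i 1) \<longlongrightarrow> x + 0 *\<^sub>R axis i 1) (nhds (0::real))"
    by (intro tendsto_intros) (simp add: filterlim_ident)
  have "\<forall>\<^sub>F y in nhds (x + 0 *\<^sub>R axis i 1). y \<in> S"
    using S by (simp add: eventually_nhds_in_open)
  then have "\<forall>\<^sub>F t in nhds 0. x + t *\<^sub>R axis i 1 \<in> S"
    using eventually_compose_filterlim lim by blast
  then have "\<forall>\<^sub>F t in nhds 0. ((\<lambda>s. u (x + s *\<^sub>R axis i 1))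
      has_real_derivative partial i u (x + t *\<^sub>R axis i 1)) (at t)"
  proof eventually_elim
    case (elim t)
    have "((\<lambda>s. u (x + (s + t) *\<^sub>R axis i 1)) has_real_derivative
        partial i u (x + t *\<^sub>R axis i 1)) (at 0)"
      using deriv[OF u[OF elim]] by (simp add: algebra_simps)
    then show ?case
      using DERIV_shift[of "\<lambda>s. u (x + s *\<^sub>R axis i 1)" _ 0 t] by simp
  qed
  then show ?thesis
    unfolding has_second_partial_def using deriv[OF pu]
    by (intro exI[of _ "\<lambda>t. partial i u (x + t *\<^sub>R axis i 1)"] conjI)
qed

lemma has_laplacian_of_C2:
  assumes "open S" "x \<in> S" "C2_on S u"
  shows "has_laplacian u x (laplacian u x)"
  unfolding has_laplacian_def laplacian_def using assms
  by (intro exI[of _ "\<lambda>i. partial i (partial i u) x"] conjI allI refl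
      has_second_partial_of_has_partial[of S]) (auto simp: C2_on_def C1_on_def)

lemma open_half_space: "open (half_space k)"
  unfolding half_space_def by (rule open_halfspace_component_gt_cart)

lemma closure_half_space: "closure (half_space k) = {x. 0 \<le> x $ k}"
  unfolding half_space_def by simp

lemma frontier_half_space: "frontier (half_space k) = {x. x $ k = 0}"
  unfolding frontier_def interior_open[OF open_half_space] closure_half_space
  by (auto simp: half_space_def)

text \<open>
  A continuous function that is bounded almost everywhere on an open strip is bounded there everywhere by
  the same constant; the lower face is covered by the boundary condition, the upper one by taking a
  slightly larger strip.
\<close>

lemma bounded_on_slab_of_L_infinity:
  assumes cont: "continuous_on {x. 0 \<le> x $ k} u" and zero: "\<And>x. x $ k = 0 \<Longrightarrow> u x = 0"
    and L: "L_infinity_on (strip k l) u" and m: "m < l"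
  shows "\<exists>M. \<forall>x \<in> closed_slab k 0 m. u x \<le> M"
proof -
  obtain C where C: "AE x in lebesgue_on (strip k l). \<bar>u x\<bar> \<le> C"
    using L unfolding L_infinity_on_def by blast
  have strip: "strip k l = {x. 0 < x $ k} \<inter> {x. x $ k < l}"
    by (auto simp: strip_def)
  have "open (strip k l)"
    unfolding strip by (intro open_Int open_halfspace_component_lt_cart open_halfspace_component_gt_cart)
  define D where "D = {x. 0 \<le> x $ k} \<inter> (\<lambda>x. \<bar>u x\<bar>) -` {..C}"
  have "closed {x :: real ^ 'a. 0 \<le> x $ k}"
    by (intro closed_Collect_le continuous_intros)
  then have "closed D"
    unfolding D_def using cont by (intro continuous_closed_preimage continuous_on_rabs closed_atMost)
  have "AE x \<in> strip k l in lebesgue. \<bar>u x\<bar> \<le> C"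
    using C \<open>open (strip k l)\<close> by (subst (asm) AE_restrict_space_iff) auto
  then have AE: "AE x \<in> strip k l in lebesgue. x \<in> D"
    by eventually_elim (auto simp: D_def strip_def)
  have "u x \<le> max 0 C" if x: "x \<in> closed_slab k 0 m" for x
  proof (cases "x $ k = 0")
    case False
    then have "x \<in> strip k l"
      using x m by (auto simp: closed_slab_def strip_def)
    then have "x \<in> D"
      by (rule mem_closed_if_AE_lebesgue_open[OF \<open>open (strip k l)\<close> \<open>closed D\<close> AE])
    then show ?thesis
      by (auto simp: D_def)
  qed (simp add: zero)
  then show ?thesis by blast
qed

lemma lipschitz_on_compact_interval:
  assumes f: "locally_lipschitz_on {0<..} f" and a: "0 < a"
  shows "\<exists>L. \<forall>s\<in>{a..b}. \<forall>t\<in>{a..b}. \<bar>f s - f t\<bar> \<le> L * \<bar>s - t\<bar>"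
proof -
  have "local_lipschitz {0} {a..b} (\<lambda>_::real. f)"
    using f[unfolded locally_lipschitz_on_def] by (rule local_lipschitz_subset) (use a in auto)
  then obtain L where "L-lipschitz_on {a..b} f"
    using local_lipschitz_compact_implies_lipschitz[of "{0::real}" "{a..b}" "\<lambda>_. f"] by auto
  then show ?thesis
    unfolding lipschitz_on_def dist_real_def by blast
qed

section \<open>Monotonicity in the half-space\<close>

theorem theorem1:
  fixes f :: "real \<Rightarrow> real" and u :: "real ^ 'n::finite \<Rightarrow> real" and k :: 'n
  assumes f_lipschitz: "locally_lipschitz_on {0<..} f"
    and f_a: "\<forall>M>0. \<exists>C>0. \<forall>s t. 0 < t \<and> t \<le> s \<and> s \<le> M \<longrightarrow> f s - f t \<le> C * (s - t)"
    and f_b: "\<exists>c0>0. \<exists>t0>0. \<forall>t. 0 < t \<and> t < t0 \<longrightarrow> f t > c0 * t"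
    and u_C2: "C2_on (half_space k) u"
    and u_cont: "continuous_on (closure (half_space k)) u"
    and u_eq: "\<forall>x\<in>half_space k. - laplacian u x = f (u x)"
    and u_pos: "\<forall>x\<in>half_space k. u x > 0"
    and u_bdry: "\<forall>x\<in>frontier (half_space k). u x = 0"
    and u_bdd: "\<forall>l>0. L_infinity_on (strip k l) u"
  shows "\<forall>x\<in>half_space k. partial k u x > 0"
proof
  have cont: "continuous_on {x. 0 \<le> x $ k} u"
    using u_cont by (simp add: closure_half_space)
  have zero: "\<And>x. x $ k = 0 \<Longrightarrow> u x = 0"
    using u_bdry by (simp add: frontier_half_space)
  interpret half_space_solution f u k
  proof
    fix x :: "real ^ 'n" assume x: "0 < x $ k"
    then have xH: "x \<in> half_space k"
      by (simp add: half_space_def)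
    then have "laplacian u x = - f (u x)"
      using u_eq by (metis minus_equation_iff)
    with has_laplacian_of_C2[OF open_half_space xH u_C2]
    show "has_laplacian u x (- f (u x))"
      by simp
    show "0 < u x"
      using u_pos xH by blast
  next
    fix l :: real
    show "\<exists>M. \<forall>x \<in> closed_slab k 0 l. u x \<le> M"
      using u_bdd by (intro bounded_on_slab_of_L_infinity[OF cont zero, of "max 1 (l + 1)"]) auto
  next
    fix M :: real
    have "0 < max 1 M"
      by simp
    then obtain C where "\<forall>s t. 0 < t \<and> t \<le> s \<and> s \<le> max 1 M \<longrightarrow> f s - f t \<le> C * (s - t)"
      using f_a by blast
    then show "\<exists>C. \<forall>s t. 0 < t \<and> t \<le> s \<and> s \<le> M \<longrightarrow> f s - f t \<le> C * (s - t)"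
      by (intro exI[of _ C]) (simp add: le_max_iff_disj)
  qed (use cont zero f_b lipschitz_on_compact_interval[OF f_lipschitz] in auto)
  fix x assume x: "x \<in> half_space k"
  define g where "g s = u (x + s *\<^sub>R axis k 1)" for s
  have xk: "0 < x $ k"
    using x by (simp add: half_space_def)
  obtain \<kappa> where \<kappa>: "0 < \<kappa>" "\<And>s. 0 \<le> s \<Longrightarrow> s \<le> x $ k \<Longrightarrow> \<kappa> * s \<le> g s - g (- s)"
    using vertical_increment[OF xk] by (auto simp: g_def)
  have "(g has_real_derivative partial k u x) (at 0)"
    using u_C2 x unfolding C2_on_def C1_on_def has_partial_at_def partial_def g_def
      DERIV_deriv_iff_real_differentiable by blast
  \<comment> \<open>This function is nonnegative to the right of \<open>0\<close> and vanishes at \<open>0\<close>, so its derivative there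
      cannot be negative.\<close>
  then have "((\<lambda>s. g s - g (- s) - \<kappa> * s) has_real_derivative 2 * partial k u x - \<kappa>) (at 0)"
    using DERIV_mirror[of g "partial k u x" 0] by (auto intro!: derivative_eq_intros)
  note deriv = has_real_derivative_neg_dec_right[OF this]
  show "0 < partial k u x"
  proof (rule ccontr)
    assume "\<not> 0 < partial k u x"
    then obtain e where e: "0 < e"
      "\<And>s. 0 < s \<Longrightarrow> s < e \<Longrightarrow> g s - g (- s) - \<kappa> * s < 0"
      using deriv \<kappa>(1) by auto
    have "0 < min e (x $ k) / 2" "min e (x $ k) / 2 < e" "min e (x $ k) / 2 \<le> x $ k"
      using e(1) xk by auto
    then show False
      using e(2)[of "min e (x $ k) / 2"] \<kappa>(2)[of "min e (x $ k) / 2"] by linarith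
  qed
qed

end
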